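(* Let $\lambda=\{\lambda_k\}_{k=0}^\infty$ be a sequence of positive real numbers. The following three conditions are equivalent: (1) $\lambda$ is log-concave, i.e. $\lambda_k^2\ge \lambda_{k-1}\lambda_{k+1}$ for all $k\ge 1$; (2) $\lambda$ is a tropical index preserver; (3) $\lambda$ is a central index preserver.
   Context: Let $P(x)=\sum_{i=0}^d a_i x^i$ be a real polynomial (with the convention $0^0=1$). A non-negative integer $k$ ($0\le k\le d$) is a central index of $P$ if there is a real $x_k\ge 0$ with $|a_k|x_k^k\ge \sum_{i\ne k}|a_i|x_k^i$. It is a tropical index of $P$ if there is a real $x_k\ge 0$ with $|a_k|x_k^k\ge \max_{i\neq k}|a_i|x_k^i$. The diagonal operator $T_\lambda:\mathbb{R}[x]\to\mathbb{R}[x]$ is the linear map with $T_\lambda(x^k)=\lambda_k x^k$. A positive sequence $\lambda$ is a tropical (resp. central) index preserver if for each real polynomial $P$ the set of tropical (resp. central) indices of $P$ is a subset of the set of tropical (resp. central) indices of $T_\lambda[P]$. *)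

theory Defs
  imports Complex_Main "HOL-Computational_Algebra.Polynomial"
begin

definition central_index :: "real poly \<Rightarrow> nat \<Rightarrow> bool" where
  "central_index P k \<longleftrightarrow> k \<le> degree P \<and>
     (\<exists>x\<ge>0. \<bar>coeff P k\<bar> * x ^ k \<ge> (\<Sum>i\<in>{..degree P} - {k}. \<bar>coeff P i\<bar> * x ^ i))"

text \<open>Dominating the maximum over all other indices is stated term by term, so that for
  constant polynomials (where there are no other indices) the condition holds vacuously.\<close>

definition tropical_index :: "real poly \<Rightarrow> nat \<Rightarrow> bool" where
  "tropical_index P k \<longleftrightarrow> k \<le> degree P \<and>
     (\<exists>x\<ge>0. \<forall>i\<in>{..degree P} - {k}. \<bar>coeff P k\<bar> * x ^ k \<ge> \<bar>coeff P i\<bar> * x ^ i)"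

definition diag_op :: "(nat \<Rightarrow> real) \<Rightarrow> real poly \<Rightarrow> real poly" where
  "diag_op l P = (\<Sum>i\<le>degree P. smult (coeff P i) (monom (l i) i))"

lemma coeff_diag_op: "coeff (diag_op l P) k = l k * coeff P k"
  by (cases "k \<le> degree P")
    (auto simp: diag_op_def coeff_sum coeff_eq_0 if_distrib cong: if_cong)

lemma diag_op_monom: "diag_op l (monom 1 k) = smult (l k) (monom 1 k)"
  by (rule poly_eqI) (simp add: coeff_diag_op)

lemma diag_op_add: "diag_op l (P + Q) = diag_op l P + diag_op l Q"
  by (rule poly_eqI) (simp add: coeff_diag_op algebra_simps)

lemma diag_op_smult: "diag_op l (smult c P) = smult c (diag_op l P)"
  by (rule poly_eqI) (simp add: coeff_diag_op)

definition log_concave_seq :: "(nat \<Rightarrow> real) \<Rightarrow> bool" where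
  "log_concave_seq l \<longleftrightarrow> (\<forall>k\<ge>1. (l k)\<^sup>2 \<ge> l (k - 1) * l (k + 1))"

definition tropical_index_preserver :: "(nat \<Rightarrow> real) \<Rightarrow> bool" where
  "tropical_index_preserver l \<longleftrightarrow>
     (\<forall>P. {k. tropical_index P k} \<subseteq> {k. tropical_index (diag_op l P) k})"

definition central_index_preserver :: "(nat \<Rightarrow> real) \<Rightarrow> bool" where
  "central_index_preserver l \<longleftrightarrow>
     (\<forall>P. {k. central_index P k} \<subseteq> {k. central_index (diag_op l P) k})"

end

theory Submission
  imports Defs
begin

text \<open>
  If \<open>l\<close> is log-concave, then around each index \<open>k\<close> it lies below a geometric sequence touching
  it at \<open>k\<close>: there is \<open>r > 0\<close> with \<open>l i \<le> (l k / r ^ k) * r ^ i\<close> for all \<open>i\<close>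
  (\<open>log_concave_geometric_majorant\<close>).  If \<open>k\<close> dominates in \<open>P\<close> at the point \<open>y\<close>, it therefore
  dominates in \<open>diag_op l P\<close> at \<open>y / r\<close>: up to the common factor \<open>l k / r ^ k\<close>, the \<open>k\<close>-th term is
  unchanged and no other term grows.  This argument serves both notions of index.

  For the converse, the index \<open>m + 1\<close> is tested on the polynomials
  \<open>d + c x ^ m + (1 + d) x ^ (m + 1) + c x ^ (m + 2)\<close>, where \<open>d > 0\<close>, with \<open>c = 1\<close> for tropical
  and \<open>c = 1/2\<close> for central indices.  In both cases \<open>m + 1\<close> is an index, with witness \<open>x = 1\<close>,
  and if it is still an index after applying the operator, then
  \<open>l m * l (m + 2) \<le> (1 + d)\<^sup>2 * (l (m + 1))\<^sup>2\<close>; log-concavity follows on letting \<open>d\<close> tend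
  to \<open>0\<close>.  The constant term \<open>d\<close> is essential: at \<open>x = 0\<close> all terms of positive degree vanish, so
  each positive index of a polynomial without constant term is trivially tropical and central.
\<close>

section \<open>Log-concave sequences preserve indices\<close>

lemma degree_diag_op:
  assumes "\<And>k. l k \<noteq> 0"
  shows "degree (diag_op l P) = degree P"
proof -
  have "coeff (diag_op l P) i = 0 \<longleftrightarrow> coeff P i = 0" for i
    using assms by (simp add: coeff_diag_op)
  then show ?thesis by (simp add: degree_def)
qed

lemma log_concave_geometric_majorant:
  fixes l :: "nat \<Rightarrow> real"
  assumes pos: "\<And>k. l k > 0" and lc: "log_concave_seq l"
  shows "\<exists>r>0. \<forall>i. l i * r ^ k \<le> l k * r ^ i"
proof -
  define q where "q i = l (Suc i) / l i" for i
  have q_pos: "q i > 0" for i by (simp add: q_def pos)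
  have l_Suc: "l (Suc i) = q i * l i" for i using pos[of i] by (simp add: q_def)
  have "q (Suc i) \<le> q i" for i
  proof -
    have "l i * l (Suc (Suc i)) \<le> (l (Suc i))\<^sup>2"
      using lc[unfolded log_concave_seq_def, rule_format, of "Suc i"] by simp
    then show ?thesis
      using pos[of i] pos[of "Suc i"] by (simp add: q_def field_simps power2_eq_square)
  qed
  then have q_anti: "q j \<le> q i" if "i \<le> j" for i j
    using that lift_Suc_antimono_le by blast
  define r where "r = q k"
  have r_pos: "r > 0" by (simp add: r_def q_pos)
  have above: "l (k + n) \<le> l k * r ^ n" for n
  proof (induction n)
    case (Suc n)
    have "l (k + Suc n) = q (k + n) * l (k + n)" by (simp add: l_Suc)
    also have "\<dots> \<le> r * (l k * r ^ n)"
      using Suc q_anti[of k "k + n"] r_pos pos[of "k + n"]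
      by (intro mult_mono) (auto simp: r_def)
    finally show ?case by (simp add: algebra_simps)
  qed simp
  have below: "l i * r ^ n \<le> l (i + n)" if "i + n \<le> k" for i n
    using that
  proof (induction n)
    case (Suc n)
    have "r * (l i * r ^ n) \<le> q (i + n) * l (i + n)"
      using Suc q_anti[of "i + n" k] r_pos pos[of i] q_pos[of "i + n"]
      by (intro mult_mono) (auto simp: r_def)
    then show ?case by (simp add: l_Suc algebra_simps)
  qed simp
  have "l i * r ^ k \<le> l k * r ^ i" for i
  proof (cases "k \<le> i")
    case True
    then obtain n where n: "i = k + n" using le_Suc_ex by blast
    have "l i * r ^ k \<le> (l k * r ^ n) * r ^ k"
      using above[of n] r_pos n by (intro mult_right_mono) auto
    then show ?thesis by (simp add: n power_add algebra_simps)
  next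
    case False
    then obtain n where n: "k = i + n" using le_Suc_ex nat_le_linear by blast
    have "(l i * r ^ n) * r ^ i \<le> l k * r ^ i"
      using below[of i n] r_pos n by (intro mult_right_mono) auto
    then show ?thesis by (simp add: n power_add algebra_simps)
  qed
  then show ?thesis using r_pos by blast
qed

text \<open>Rescaling the evaluation point by the ratio of the geometric majorant turns the terms of
  \<open>diag_op l P\<close> into those of \<open>P\<close>, multiplied by factors that are largest at the index \<open>k\<close>.\<close>

lemma log_concave_rescaled_terms:
  assumes pos: "\<And>k. l k > 0" and lc: "log_concave_seq l" and y: "y \<ge> 0"
  obtains x c where "x \<ge> 0" "c > 0"
    "\<bar>coeff (diag_op l P) k\<bar> * x ^ k = c * (\<bar>coeff P k\<bar> * y ^ k)"
    "\<And>i. \<bar>coeff (diag_op l P) i\<bar> * x ^ i \<le> c * (\<bar>coeff P i\<bar> * y ^ i)"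
proof -
  obtain r where r: "r > 0" and le: "\<And>i. l i * r ^ k \<le> l k * r ^ i"
    using log_concave_geometric_majorant[OF pos lc] by blast
  have abs_coeff: "\<bar>coeff (diag_op l P) i\<bar> = l i * \<bar>coeff P i\<bar>" for i
    using pos[of i] by (simp add: coeff_diag_op abs_mult)
  show thesis
  proof
    show "y / r \<ge> 0" "l k / r ^ k > 0" using y r pos[of k] by auto
    show "\<bar>coeff (diag_op l P) k\<bar> * (y / r) ^ k = l k / r ^ k * (\<bar>coeff P k\<bar> * y ^ k)"
      by (simp add: abs_coeff power_divide)
    show "\<bar>coeff (diag_op l P) i\<bar> * (y / r) ^ i \<le> l k / r ^ k * (\<bar>coeff P i\<bar> * y ^ i)" for i
    proof -
      have "l i / r ^ i \<le> l k / r ^ k" using le[of i] r by (simp add: field_simps)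
      then have "l i / r ^ i * (\<bar>coeff P i\<bar> * y ^ i) \<le> l k / r ^ k * (\<bar>coeff P i\<bar> * y ^ i)"
        using y by (intro mult_right_mono) auto
      then show ?thesis by (simp add: abs_coeff power_divide)
    qed
  qed
qed

lemma log_concave_imp_tropical_index_preserver:
  assumes pos: "\<And>k. l k > 0" and lc: "log_concave_seq l"
  shows "tropical_index_preserver l"
  unfolding tropical_index_preserver_def
proof (intro allI subsetI, unfold mem_Collect_eq)
  fix P k assume "tropical_index P k"
  then obtain y where k: "k \<le> degree P" and y: "y \<ge> 0"
    and dom: "\<And>i. i \<in> {..degree P} - {k} \<Longrightarrow> \<bar>coeff P i\<bar> * y ^ i \<le> \<bar>coeff P k\<bar> * y ^ k"
    unfolding tropical_index_def by blast
  obtain x c where x: "x \<ge> 0" and c: "c > 0"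
    and eq: "\<bar>coeff (diag_op l P) k\<bar> * x ^ k = c * (\<bar>coeff P k\<bar> * y ^ k)"
    and le: "\<And>i. \<bar>coeff (diag_op l P) i\<bar> * x ^ i \<le> c * (\<bar>coeff P i\<bar> * y ^ i)"
    using log_concave_rescaled_terms[OF pos lc y] by blast
  have "\<bar>coeff (diag_op l P) i\<bar> * x ^ i \<le> \<bar>coeff (diag_op l P) k\<bar> * x ^ k"
    if "i \<in> {..degree P} - {k}" for i
    unfolding eq using le[of i] mult_left_mono[OF dom[OF that], of c] c by linarith
  then show "tropical_index (diag_op l P) k"
    using k x pos unfolding tropical_index_def by (auto simp: degree_diag_op less_imp_neq[symmetric])
qed

lemma log_concave_imp_central_index_preserver:
  assumes pos: "\<And>k. l k > 0" and lc: "log_concave_seq l"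
  shows "central_index_preserver l"
  unfolding central_index_preserver_def
proof (intro allI subsetI, unfold mem_Collect_eq)
  fix P k assume "central_index P k"
  then obtain y where k: "k \<le> degree P" and y: "y \<ge> 0"
    and dom: "(\<Sum>i\<in>{..degree P} - {k}. \<bar>coeff P i\<bar> * y ^ i) \<le> \<bar>coeff P k\<bar> * y ^ k"
    unfolding central_index_def by blast
  obtain x c where x: "x \<ge> 0" and c: "c > 0"
    and eq: "\<bar>coeff (diag_op l P) k\<bar> * x ^ k = c * (\<bar>coeff P k\<bar> * y ^ k)"
    and le: "\<And>i. \<bar>coeff (diag_op l P) i\<bar> * x ^ i \<le> c * (\<bar>coeff P i\<bar> * y ^ i)"
    using log_concave_rescaled_terms[OF pos lc y] by blast
  have "(\<Sum>i\<in>{..degree P} - {k}. \<bar>coeff (diag_op l P) i\<bar> * x ^ i)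
      \<le> c * (\<Sum>i\<in>{..degree P} - {k}. \<bar>coeff P i\<bar> * y ^ i)"
    unfolding sum_distrib_left by (intro sum_mono le)
  also have "\<dots> \<le> \<bar>coeff (diag_op l P) k\<bar> * x ^ k"
    unfolding eq using dom c by simp
  finally show "central_index (diag_op l P) k"
    using k x pos unfolding central_index_def by (auto simp: degree_diag_op less_imp_neq[symmetric])
qed

section \<open>Test polynomials\<close>

lemma dominating_point_nonzero:
  fixes P :: "real poly"
  assumes "coeff P 0 \<noteq> 0" "k > 0" "\<bar>coeff P 0\<bar> * x ^ 0 \<le> \<bar>coeff P k\<bar> * x ^ k"
  shows "x \<noteq> 0"
proof
  assume "x = 0"
  with assms(2,3) have "\<bar>coeff P 0\<bar> \<le> 0" by (simp add: zero_power)
  with assms(1) show False by simp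
qed

text \<open>The test polynomial \<open>d + c x ^ m + (1 + d) x ^ (m + 1) + c x ^ (m + 2)\<close>.  The middle
  coefficient exceeds \<open>1\<close> by \<open>d\<close> in order to dominate at \<open>x = 1\<close>: for central indices \<open>d\<close> is
  part of the sum of the other coefficients, and for tropical indices with \<open>m = 0\<close> the first two
  terms merge into the constant term \<open>c + d\<close>.\<close>

definition test_poly :: "real \<Rightarrow> real \<Rightarrow> nat \<Rightarrow> real poly" where
  "test_poly c d m = monom d 0 + monom c m + monom (1 + d) (Suc m) + monom c (Suc (Suc m))"

lemma coeff_test_poly:
  "coeff (test_poly c d m) i = (if i = 0 then d else 0) + (if i = m then c else 0)
     + (if i = Suc m then 1 + d else 0) + (if i = Suc (Suc m) then c else 0)"
  by (auto simp: test_poly_def)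

lemma degree_test_poly:
  assumes "c \<noteq> 0"
  shows "degree (test_poly c d m) = Suc (Suc m)"
proof (rule antisym)
  show "degree (test_poly c d m) \<le> Suc (Suc m)"
    by (rule degree_le) (simp add: coeff_test_poly)
  show "Suc (Suc m) \<le> degree (test_poly c d m)"
    using assms by (intro le_degree) (simp add: coeff_test_poly)
qed

lemma tropical_index_test_poly:
  assumes "d > 0"
  shows "tropical_index (test_poly 1 d m) (Suc m)"
  unfolding tropical_index_def using assms
  by (intro conjI exI[of _ 1]) (auto simp: degree_test_poly coeff_test_poly)

lemma central_index_test_poly:
  assumes "d > 0"
  shows "central_index (test_poly (1/2) d m) (Suc m)"
proof -
  let ?P = "test_poly (1/2) d m"
  have "(\<Sum>i\<in>{..degree ?P} - {Suc m}. \<bar>coeff ?P i\<bar> * 1 ^ i)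
      = (\<Sum>i\<in>{..degree ?P} - {Suc m}. coeff ?P i * 1 ^ i)"
    using assms by (intro sum.cong refl) (simp add: coeff_test_poly)
  also have "\<dots> = poly ?P 1 - coeff ?P (Suc m) * 1 ^ Suc m"
    unfolding poly_altdef by (subst sum_diff1) (auto simp: degree_test_poly)
  also have "\<dots> = \<bar>coeff ?P (Suc m)\<bar> * 1 ^ Suc m"
    using assms by (simp add: coeff_test_poly) (simp add: test_poly_def poly_monom)
  finally show ?thesis
    unfolding central_index_def by (intro conjI exI[of _ 1]) (auto simp: degree_test_poly)
qed

lemma abs_coeff_diag_op_test_poly:
  assumes pos: "\<And>k. l k > 0" and "c > 0" "d > 0"
  shows "\<bar>coeff (diag_op l (test_poly c d m)) m\<bar> \<ge> c * l m"
    and "\<bar>coeff (diag_op l (test_poly c d m)) (Suc m)\<bar> = (1 + d) * l (Suc m)"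
    and "\<bar>coeff (diag_op l (test_poly c d m)) (Suc (Suc m))\<bar> = c * l (Suc (Suc m))"
    and "coeff (diag_op l (test_poly c d m)) 0 \<noteq> 0"
proof -
  have pos': "l k \<noteq> 0" "l k \<ge> 0" for k
    using pos[of k] by auto
  have "\<bar>coeff (diag_op l (test_poly c d m)) i\<bar> = l i * coeff (test_poly c d m) i" for i
    using pos' assms by (simp add: coeff_diag_op coeff_test_poly abs_mult)
  note abs_coeff = this
  show "\<bar>coeff (diag_op l (test_poly c d m)) m\<bar> \<ge> c * l m"
    using assms pos' by (simp add: abs_coeff coeff_test_poly algebra_simps)
  show "\<bar>coeff (diag_op l (test_poly c d m)) (Suc m)\<bar> = (1 + d) * l (Suc m)"
    and "\<bar>coeff (diag_op l (test_poly c d m)) (Suc (Suc m))\<bar> = c * l (Suc (Suc m))"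
    by (simp_all add: abs_coeff coeff_test_poly)
  show "coeff (diag_op l (test_poly c d m)) 0 \<noteq> 0"
    using assms pos' by (simp add: coeff_diag_op coeff_test_poly)
qed

section \<open>Index preservers are log-concave\<close>

text \<open>Passage to the limit \<open>d \<rightarrow> 0\<close>.\<close>

lemma log_concave_seqI_approx:
  fixes l :: "nat \<Rightarrow> real"
  assumes "\<And>m d. d > 0 \<Longrightarrow> l m * l (Suc (Suc m)) \<le> ((1 + d) * l (Suc m))\<^sup>2"
  shows "log_concave_seq l"
  unfolding log_concave_seq_def
proof (intro allI impI)
  fix k :: nat assume "1 \<le> k"
  then obtain m where k: "k = Suc m" using not0_implies_Suc by fastforce
  have "((\<lambda>d. ((1 + d) * l k)\<^sup>2) \<longlongrightarrow> ((1 + 0) * l k)\<^sup>2) (at_right 0)"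
    by (intro tendsto_intros)
  moreover have "\<forall>\<^sub>F d in at_right 0. l m * l (Suc k) \<le> ((1 + d) * l k)\<^sup>2"
    using assms[of _ m] k by (auto intro: eventually_at_rightI[of 0 1])
  ultimately have "l m * l (Suc k) \<le> ((1 + 0) * l k)\<^sup>2"
    by (rule tendsto_lowerbound) simp
  then show "l (k - 1) * l (k + 1) \<le> (l k)\<^sup>2" by (simp add: k)
qed

lemma tropical_index_preserver_imp_log_concave:
  assumes pos: "\<And>k. l k > 0" and pres: "tropical_index_preserver l"
  shows "log_concave_seq l"
proof (rule log_concave_seqI_approx)
  fix m and d :: real assume d: "d > 0"
  let ?Q = "diag_op l (test_poly 1 d m)"
  note Q = abs_coeff_diag_op_test_poly[where l = l and m = m, OF pos zero_less_one d]
  have deg: "degree ?Q = Suc (Suc m)"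
    using pos by (simp add: degree_diag_op degree_test_poly less_imp_neq[symmetric])
  have "tropical_index ?Q (Suc m)"
    using pres tropical_index_test_poly[OF d] unfolding tropical_index_preserver_def by blast
  then obtain x where x: "x \<ge> 0"
    and dom: "\<And>i. i \<le> Suc (Suc m) \<Longrightarrow> i \<noteq> Suc m \<Longrightarrow>
                \<bar>coeff ?Q i\<bar> * x ^ i \<le> \<bar>coeff ?Q (Suc m)\<bar> * x ^ Suc m"
    unfolding tropical_index_def deg by auto
  have "x \<noteq> 0" using dominating_point_nonzero[OF Q(4) _ dom[of 0]] by simp
  with x have x: "x > 0" by simp
  define u where "u = (1 + d) * l (Suc m)"
  have "l m * x ^ m \<le> u * x ^ Suc m"
    using dom[of m] Q(2) mult_right_mono[OF Q(1), of "x ^ m"] x by (simp add: u_def)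
  then have 1: "l m \<le> u * x" using x by (simp add: mult.assoc[symmetric])
  have "l (Suc (Suc m)) * x ^ Suc (Suc m) \<le> u * x ^ Suc m"
    using dom[of "Suc (Suc m)"] Q(2,3) by (simp add: u_def)
  then have 2: "l (Suc (Suc m)) * x \<le> u" using x by (simp add: mult.assoc[symmetric])
  have "l m * (l (Suc (Suc m)) * x) \<le> (u * x) * u"
    using 1 2 pos[of m] pos[of "Suc (Suc m)"] x by (intro mult_mono) auto
  then have "(l m * l (Suc (Suc m))) * x \<le> u\<^sup>2 * x"
    by (simp add: power2_eq_square algebra_simps)
  then show "l m * l (Suc (Suc m)) \<le> ((1 + d) * l (Suc m))\<^sup>2"
    using x by (simp add: u_def)
qed

lemma central_index_preserver_imp_log_concave:
  assumes pos: "\<And>k. l k > 0" and pres: "central_index_preserver l"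
  shows "log_concave_seq l"
proof (rule log_concave_seqI_approx)
  fix m and d :: real assume d: "d > 0"
  let ?Q = "diag_op l (test_poly (1/2) d m)"
  have "(1/2 :: real) > 0" by simp
  note Q = abs_coeff_diag_op_test_poly[where l = l and m = m, OF pos this d]
  have deg: "degree ?Q = Suc (Suc m)"
    using pos by (simp add: degree_diag_op degree_test_poly less_imp_neq[symmetric])
  have "central_index ?Q (Suc m)"
    using pres central_index_test_poly[OF d] unfolding central_index_preserver_def by blast
  then obtain x where x: "x \<ge> 0"
    and dom: "(\<Sum>i\<in>{..Suc (Suc m)} - {Suc m}. \<bar>coeff ?Q i\<bar> * x ^ i)
                \<le> \<bar>coeff ?Q (Suc m)\<bar> * x ^ Suc m"
    unfolding central_index_def deg by auto
  have sum_le: "(\<Sum>i\<in>A. \<bar>coeff ?Q i\<bar> * x ^ i) \<le> \<bar>coeff ?Q (Suc m)\<bar> * x ^ Suc m"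
    if "A \<subseteq> {..Suc (Suc m)} - {Suc m}" for A
    using that x by (intro order_trans[OF sum_mono2 dom]) auto
  have "\<bar>coeff ?Q 0\<bar> * x ^ 0 \<le> \<bar>coeff ?Q (Suc m)\<bar> * x ^ Suc m" using sum_le[of "{0}"] by simp
  then have "x \<noteq> 0" by (rule dominating_point_nonzero[OF Q(4) zero_less_Suc])
  with x have x: "x > 0" by simp
  define u where "u = (1 + d) * l (Suc m)"
  let ?a = "l m" and ?b = "l (Suc (Suc m))"
  have "?a * x ^ m + ?b * x ^ Suc (Suc m) \<le> 2 * u * x ^ Suc m"
  proof -
    have "\<bar>coeff ?Q m\<bar> * x ^ m + 1/2 * ?b * x ^ Suc (Suc m) \<le> u * x ^ Suc m"
      using sum_le[of "{m, Suc (Suc m)}"] Q(2,3) by (simp add: u_def)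
    moreover have "1/2 * ?a * x ^ m \<le> \<bar>coeff ?Q m\<bar> * x ^ m"
      using mult_right_mono[OF Q(1), of "x ^ m"] x by simp
    ultimately show ?thesis by linarith
  qed
  then have "(?a + ?b * x\<^sup>2) * x ^ m \<le> (2 * u * x) * x ^ m"
    by (simp add: power2_eq_square algebra_simps)
  then have quad: "?a + ?b * x\<^sup>2 \<le> 2 * u * x" using x by simp
  \<comment> \<open>A quadratic with a nonpositive value and positive leading coefficient has nonnegative
    discriminant.\<close>
  have "?b * (?a + ?b * x\<^sup>2) \<le> ?b * (2 * u * x)"
    using quad pos[of "Suc (Suc m)"] by simp
  moreover have "0 \<le> (?b * x - u)\<^sup>2" by simp
  ultimately have "?a * ?b \<le> u\<^sup>2"
    by (simp add: power2_eq_square algebra_simps)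
  then show "?a * ?b \<le> ((1 + d) * l (Suc m))\<^sup>2" by (simp add: u_def)
qed

theorem theorem5:
  fixes l :: "nat \<Rightarrow> real"
  assumes "\<And>k. l k > 0"
  shows "(log_concave_seq l \<longleftrightarrow> tropical_index_preserver l) \<and>
         (tropical_index_preserver l \<longleftrightarrow> central_index_preserver l)"
  using log_concave_imp_tropical_index_preserver[of l]
    log_concave_imp_central_index_preserver[of l]
    tropical_index_preserver_imp_log_concave[of l]
    central_index_preserver_imp_log_concave[of l] assms
  by blast

end
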